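(* For every positive integer $m$ there exist a metric space $X$ with a basepoint $e\in X$ and a scaling factor $\alpha=(\alpha_n)_{n\in\mathbb{N}}$ such that for every non-principal ultrafilter $\mu$ on $\mathbb{N}$ and all natural numbers $i,j$, the iterated asymptotic cones $\operatorname{Cone}^i_\mu(X,e,\alpha)$ and $\operatorname{Cone}^j_\mu(X,e,\alpha)$ are homeomorphic if and only if $i\equiv j\pmod m$.
   Context: A scaling factor is a sequence $\alpha=(\alpha_n)_{n\in\mathbb{N}}$ of positive real numbers diverging to $+\infty$. For an ultrafilter $\mu$ on $\mathbb{N}$ and a sequence $(x_n)$ in $[0,+\infty]$, $\mu\text{-}\lim x_n$ is the unique $a\in[0,+\infty]$ such that for every neighborhood $U$ of $a$ one has $\{n: x_n\in U\}\in\mu$. Asymptotic cone: for a metric space $(X,d)$, a non-principal ultrafilter $\mu$ on $\mathbb{N}$, a sequence $e=(e_n)$ of points of $X$ (a single point $e\in X$ is identified with the constant sequence) and a scaling factor $\alpha$, $\operatorname{Cone}_\mu(X,e,\alpha)$ is the quotient of $\{(x_n)\in X^{\mathbb{N}}: \mu\text{-}\lim d(x_n,e_n)/\alpha_n<+\infty\}$ by the relation $(x_n)\approx(y_n)\iff \mu\text{-}\lim d(x_n,y_n)/\alpha_n=0$, with metric $d_\infty([x_n],[y_n])=\mu\text{-}\lim d(x_n,y_n)/\alpha_n$. Iterated asymptotic cones: for $e\in X$ set $\operatorname{Cone}^0_\mu(X,e,\alpha)=X$, $e(0)=e$, and for $i\in\mathbb{N}$ set $\operatorname{Cone}^{i+1}_\mu(X,e,\alpha)=\operatorname{Cone}_\mu(\operatorname{Cone}^i_\mu(X,e,\alpha),e(i),\alpha)$,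 where $e(i+1)$ is the class of the constant sequence with value $e(i)$. Natural numbers include $0$. *)

theory Defs
  imports "HOL-Analysis.Analysis" "HOL-Number_Theory.Cong"
begin

section \<open>Ultrafilters, ultralimits and scaling factors\<close>

text \<open>A family of subsets of the index set is represented by a filter \<open>\<mu>\<close> of the library;
  \<open>{n. P n}\<close> belongs to the family iff \<open>eventually P \<mu>\<close>.\<close>

definition ultrafilter :: "'i filter \<Rightarrow> bool" where
  "ultrafilter \<mu> \<longleftrightarrow>
     \<mu> \<noteq> bot \<and> (\<forall>P. eventually P \<mu> \<or> eventually (\<lambda>n. \<not> P n) \<mu>)"

definition nonprincipal_ultrafilter :: "'i filter \<Rightarrow> bool" where
  "nonprincipal_ultrafilter \<mu> \<longleftrightarrow> ultrafilter \<mu> \<and> (\<forall>k. \<mu> \<noteq> principal {k})"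

definition scaling_factor :: "(nat \<Rightarrow> real) \<Rightarrow> bool" where
  "scaling_factor \<alpha> \<longleftrightarrow> (\<forall>n. 0 < \<alpha> n) \<and> filterlim \<alpha> at_top sequentially"

text \<open>The ultralimit of a sequence in \<open>[0,\<infinity>]\<close> is the library limit \<open>Lim \<mu>\<close> at the type
  \<^typ>\<open>ennreal\<close>. Along an ultrafilter it always exists:\<close>

lemma ultrafilter_tendsto_Lim:
  fixes f :: "'i \<Rightarrow> ennreal"
  assumes "ultrafilter \<mu>"
  shows "(f \<longlongrightarrow> Lim \<mu> f) \<mu>"
proof -
  have nb: "\<mu> \<noteq> bot" and ult: "\<And>P. eventually P \<mu> \<or> eventually (\<lambda>n. \<not> P n) \<mu>"
    using assms by (auto simp: ultrafilter_def)
  have "compact (UNIV :: ennreal set)"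
    by (rule compact_UNIV)
  moreover have "filtermap f \<mu> \<noteq> bot"
    using nb by (simp add: filtermap_bot_iff)
  ultimately obtain a where a: "inf (nhds a) (filtermap f \<mu>) \<noteq> bot"
    by (auto simp: compact_filter)
  have "(f \<longlongrightarrow> a) \<mu>"
  proof (rule topological_tendstoI)
    fix S assume S: "open S" "a \<in> S"
    have "\<not> eventually (\<lambda>n. f n \<notin> S) \<mu>"
    proof
      assume "eventually (\<lambda>n. f n \<notin> S) \<mu>"
      then have "eventually (\<lambda>x. x \<notin> S) (filtermap f \<mu>)"
        by (simp add: eventually_filtermap)
      moreover have "eventually (\<lambda>x. x \<in> S) (nhds a)"
        using S by (rule eventually_nhds_in_open)
      ultimately have "eventually (\<lambda>_. False) (inf (nhds a) (filtermap f \<mu>))"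
        unfolding eventually_inf by blast
      with a show False
        by (simp add: trivial_limit_def)
    qed
    with ult show "eventually (\<lambda>n. f n \<in> S) \<mu>"
      by blast
  qed
  moreover from this nb have "Lim \<mu> f = a"
    by (rule tendsto_Lim[rotated])
  ultimately show ?thesis
    by simp
qed

section \<open>Asymptotic cones\<close>

definition scaled_dist ::
    "'a metric \<Rightarrow> (nat \<Rightarrow> real) \<Rightarrow> nat filter \<Rightarrow> (nat \<Rightarrow> 'a) \<Rightarrow> (nat \<Rightarrow> 'a) \<Rightarrow> ennreal" where
  "scaled_dist X \<alpha> \<mu> x y = Lim \<mu> (\<lambda>n. ennreal (mdist X (x n) (y n) / \<alpha> n))"

definition cone_seqs ::
    "'a metric \<Rightarrow> (nat \<Rightarrow> 'a) \<Rightarrow> (nat \<Rightarrow> real) \<Rightarrow> nat filter \<Rightarrow> (nat \<Rightarrow> 'a) set" where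
  "cone_seqs X e \<alpha> \<mu> = {x. (\<forall>n. x n \<in> mspace X) \<and> scaled_dist X \<alpha> \<mu> x e < \<infinity>}"

definition cone_rel ::
    "'a metric \<Rightarrow> (nat \<Rightarrow> 'a) \<Rightarrow> (nat \<Rightarrow> real) \<Rightarrow> nat filter \<Rightarrow> ((nat \<Rightarrow> 'a) \<times> (nat \<Rightarrow> 'a)) set" where
  "cone_rel X e \<alpha> \<mu> =
     {(x, y). x \<in> cone_seqs X e \<alpha> \<mu> \<and> y \<in> cone_seqs X e \<alpha> \<mu> \<and> scaled_dist X \<alpha> \<mu> x y = 0}"

text \<open>The metric is evaluated on arbitrary representatives; see \<open>mdist_asymp_cone\<close> below for the
  independence of that choice.\<close>

definition asymp_cone ::
    "'a metric \<Rightarrow> (nat \<Rightarrow> 'a) \<Rightarrow> (nat \<Rightarrow> real) \<Rightarrow> nat filter \<Rightarrow> (nat \<Rightarrow> 'a) set metric" where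
  "asymp_cone X e \<alpha> \<mu> =
     metric (cone_seqs X e \<alpha> \<mu> // cone_rel X e \<alpha> \<mu>,
             \<lambda>A B. enn2real (scaled_dist X \<alpha> \<mu> (SOME x. x \<in> A) (SOME y. y \<in> B)))"

lemma scaled_dist_commute: "scaled_dist X \<alpha> \<mu> x y = scaled_dist X \<alpha> \<mu> y x"
  by (simp add: scaled_dist_def mdist_commute)

lemma scaled_dist_self:
  assumes "ultrafilter \<mu>" "\<And>n. x n \<in> mspace X"
  shows "scaled_dist X \<alpha> \<mu> x x = 0"
proof -
  have "mdist X (x n) (x n) = 0" for n
    using assms(2) by simp
  moreover have "\<mu> \<noteq> bot"
    using assms(1) by (simp add: ultrafilter_def)
  ultimately show ?thesis
    by (simp add: scaled_dist_def tendsto_Lim)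
qed

lemma scaled_dist_triangle:
  assumes "ultrafilter \<mu>" "scaling_factor \<alpha>"
    and "\<And>n. x n \<in> mspace X" "\<And>n. y n \<in> mspace X" "\<And>n. z n \<in> mspace X"
  shows "scaled_dist X \<alpha> \<mu> x z \<le> scaled_dist X \<alpha> \<mu> x y + scaled_dist X \<alpha> \<mu> y z"
proof -
  let ?f = "\<lambda>u v n. ennreal (mdist X (u n) (v n) / \<alpha> n)"
  have \<alpha>: "0 < \<alpha> n" for n
    using assms by (simp add: scaling_factor_def)
  have le: "?f x z n \<le> ?f x y n + ?f y z n" for n
  proof -
    have "mdist X (x n) (z n) / \<alpha> n \<le> mdist X (x n) (y n) / \<alpha> n + mdist X (y n) (z n) / \<alpha> n"
      unfolding add_divide_distrib[symmetric]
      by (intro divide_right_mono mdist_triangle assms less_imp_le \<alpha>)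
    then have "?f x z n \<le> ennreal (mdist X (x n) (y n) / \<alpha> n + mdist X (y n) (z n) / \<alpha> n)"
      by (rule ennreal_leI)
    also have "\<dots> = ?f x y n + ?f y z n"
      using \<alpha>[of n] by (intro ennreal_plus) auto
    finally show ?thesis .
  qed
  have "(?f x z \<longlongrightarrow> Lim \<mu> (?f x z)) \<mu>"
    "((\<lambda>n. ?f x y n + ?f y z n) \<longlongrightarrow> Lim \<mu> (?f x y) + Lim \<mu> (?f y z)) \<mu>"
    by (intro tendsto_add ultrafilter_tendsto_Lim assms)+
  moreover have "\<mu> \<noteq> bot"
    using assms by (simp add: ultrafilter_def)
  ultimately show ?thesis
    unfolding scaled_dist_def using le by (intro tendsto_le[of \<mu>]) auto
qed

lemma equiv_cone_rel:
  assumes "ultrafilter \<mu>" "scaling_factor \<alpha>"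
  shows "equiv (cone_seqs X e \<alpha> \<mu>) (cone_rel X e \<alpha> \<mu>)"
proof (rule equivI)
  show "cone_rel X e \<alpha> \<mu> \<subseteq> cone_seqs X e \<alpha> \<mu> \<times> cone_seqs X e \<alpha> \<mu>"
    by (auto simp: cone_rel_def)
  show "refl_on (cone_seqs X e \<alpha> \<mu>) (cone_rel X e \<alpha> \<mu>)"
    using assms by (auto simp: refl_on_def cone_rel_def cone_seqs_def scaled_dist_self)
  show "sym (cone_rel X e \<alpha> \<mu>)"
    by (auto simp: sym_def cone_rel_def scaled_dist_commute)
  show "trans (cone_rel X e \<alpha> \<mu>)"
  proof (rule transI)
    fix x y z assume "(x, y) \<in> cone_rel X e \<alpha> \<mu>" "(y, z) \<in> cone_rel X e \<alpha> \<mu>"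
    then show "(x, z) \<in> cone_rel X e \<alpha> \<mu>"
      using scaled_dist_triangle[OF assms, of x X y z] by (auto simp: cone_rel_def cone_seqs_def)
  qed
qed

lemma scaled_dist_cong:
  assumes "ultrafilter \<mu>" "scaling_factor \<alpha>"
    and "(x, x') \<in> cone_rel X e \<alpha> \<mu>" "(y, y') \<in> cone_rel X e \<alpha> \<mu>"
  shows "scaled_dist X \<alpha> \<mu> x y = scaled_dist X \<alpha> \<mu> x' y'"
proof -
  have le: "scaled_dist X \<alpha> \<mu> x y \<le> scaled_dist X \<alpha> \<mu> x' y'"
    if xx: "(x, x') \<in> cone_rel X e \<alpha> \<mu>" and yy: "(y, y') \<in> cone_rel X e \<alpha> \<mu>" for x x' y y'
  proof -
    have in_X: "\<And>n. x n \<in> mspace X" "\<And>n. x' n \<in> mspace X" "\<And>n. y n \<in> mspace X" "\<And>n. y' n \<in> mspace X"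
      and zero: "scaled_dist X \<alpha> \<mu> x x' = 0" "scaled_dist X \<alpha> \<mu> y' y = 0"
      using xx yy by (auto simp: cone_rel_def cone_seqs_def scaled_dist_commute)
    have "scaled_dist X \<alpha> \<mu> x y \<le> scaled_dist X \<alpha> \<mu> x x' + scaled_dist X \<alpha> \<mu> x' y"
      using in_X by (intro scaled_dist_triangle assms) auto
    also have "scaled_dist X \<alpha> \<mu> x' y \<le> scaled_dist X \<alpha> \<mu> x' y' + scaled_dist X \<alpha> \<mu> y' y"
      using in_X by (intro scaled_dist_triangle assms) auto
    finally show ?thesis
      using zero by (simp add: add_left_mono)
  qed
  have "(x', x) \<in> cone_rel X e \<alpha> \<mu>" "(y', y) \<in> cone_rel X e \<alpha> \<mu>"
    using assms(3,4) by (auto simp: cone_rel_def scaled_dist_commute)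
  then show ?thesis
    using le assms(3,4) by (meson order_antisym)
qed

lemma some_in_quotient:
  assumes "equiv S r" "A \<in> S // r"
  shows "(SOME x. x \<in> A) \<in> A"
proof -
  have "A \<noteq> {}"
    using in_quotient_imp_non_empty[OF assms] .
  then show ?thesis
    by (auto simp: some_in_eq)
qed

lemma Metric_space_asymp_cone:
  assumes "ultrafilter \<mu>" "scaling_factor \<alpha>" "\<And>n. e n \<in> mspace X"
  shows "Metric_space (cone_seqs X e \<alpha> \<mu> // cone_rel X e \<alpha> \<mu>)
           (\<lambda>A B. enn2real (scaled_dist X \<alpha> \<mu> (SOME x. x \<in> A) (SOME y. y \<in> B)))"
proof -
  let ?S = "cone_seqs X e \<alpha> \<mu>" and ?r = "cone_rel X e \<alpha> \<mu>"
  note eq = equiv_cone_rel[OF assms(1,2), of X e]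
  have rep: "(SOME x. x \<in> A) \<in> A" "(SOME x. x \<in> A) \<in> ?S" if "A \<in> ?S // ?r" for A
    using some_in_quotient[OF eq that] in_quotient_imp_subset[OF eq that] by auto
  have in_X: "\<And>n. x n \<in> mspace X" if "x \<in> ?S" for x
    using that by (auto simp: cone_seqs_def)
  have fin: "scaled_dist X \<alpha> \<mu> x y < \<infinity>" if "x \<in> ?S" "y \<in> ?S" for x y
  proof -
    have "scaled_dist X \<alpha> \<mu> x y \<le> scaled_dist X \<alpha> \<mu> x e + scaled_dist X \<alpha> \<mu> e y"
      using that assms by (intro scaled_dist_triangle) (auto simp: in_X)
    also have "\<dots> < \<infinity>"
      using that by (auto simp: cone_seqs_def scaled_dist_commute[of X \<alpha> \<mu> e])
    finally show ?thesis .
  qed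
  show ?thesis
  proof
    fix A B assume AB: "A \<in> ?S // ?r" "B \<in> ?S // ?r"
    let ?x = "SOME x. x \<in> A" and ?y = "SOME y. y \<in> B"
    have "enn2real (scaled_dist X \<alpha> \<mu> ?x ?y) = 0 \<longleftrightarrow> (?x, ?y) \<in> ?r"
      using fin[of ?x ?y] rep AB by (auto simp: enn2real_eq_0_iff cone_rel_def)
    also have "\<dots> \<longleftrightarrow> A = B"
      using quotient_eq_iff[OF eq AB] rep AB by auto
    finally show "enn2real (scaled_dist X \<alpha> \<mu> ?x ?y) = 0 \<longleftrightarrow> A = B" .
  next
    fix A B C assume ABC: "A \<in> ?S // ?r" "B \<in> ?S // ?r" "C \<in> ?S // ?r"
    let ?x = "SOME x. x \<in> A" and ?y = "SOME y. y \<in> B" and ?z = "SOME z. z \<in> C"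
    have "scaled_dist X \<alpha> \<mu> ?x ?z \<le> scaled_dist X \<alpha> \<mu> ?x ?y + scaled_dist X \<alpha> \<mu> ?y ?z"
      using rep ABC by (intro scaled_dist_triangle assms in_X)
    moreover have fin': "scaled_dist X \<alpha> \<mu> ?x ?y < top" "scaled_dist X \<alpha> \<mu> ?y ?z < top"
      using rep(2) ABC fin[unfolded infinity_ennreal_def] by blast+
    ultimately have "enn2real (scaled_dist X \<alpha> \<mu> ?x ?z)
        \<le> enn2real (scaled_dist X \<alpha> \<mu> ?x ?y + scaled_dist X \<alpha> \<mu> ?y ?z)"
      by (intro enn2real_mono) auto
    also have "\<dots> = enn2real (scaled_dist X \<alpha> \<mu> ?x ?y) + enn2real (scaled_dist X \<alpha> \<mu> ?y ?z)"
      using fin' by (rule enn2real_plus)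
    finally show "enn2real (scaled_dist X \<alpha> \<mu> ?x ?z)
        \<le> enn2real (scaled_dist X \<alpha> \<mu> ?x ?y) + enn2real (scaled_dist X \<alpha> \<mu> ?y ?z)" .
  qed (simp_all only: enn2real_nonneg scaled_dist_commute)
qed

lemma mspace_asymp_cone:
  assumes "ultrafilter \<mu>" "scaling_factor \<alpha>" "\<And>n. e n \<in> mspace X"
  shows "mspace (asymp_cone X e \<alpha> \<mu>) = cone_seqs X e \<alpha> \<mu> // cone_rel X e \<alpha> \<mu>"
  unfolding asymp_cone_def by (rule Metric_space.mspace_metric[OF Metric_space_asymp_cone[OF assms]])

lemma mdist_asymp_cone:
  assumes "ultrafilter \<mu>" "scaling_factor \<alpha>" "\<And>n. e n \<in> mspace X"
    and "x \<in> cone_seqs X e \<alpha> \<mu>" "y \<in> cone_seqs X e \<alpha> \<mu>"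
  shows "mdist (asymp_cone X e \<alpha> \<mu>) (cone_rel X e \<alpha> \<mu> `` {x}) (cone_rel X e \<alpha> \<mu> `` {y}) =
           enn2real (scaled_dist X \<alpha> \<mu> x y)"
proof -
  note eq = equiv_cone_rel[OF assms(1,2), of X e]
  let ?x = "SOME x'. x' \<in> cone_rel X e \<alpha> \<mu> `` {x}"
  let ?y = "SOME y'. y' \<in> cone_rel X e \<alpha> \<mu> `` {y}"
  have "(x, ?x) \<in> cone_rel X e \<alpha> \<mu>" "(y, ?y) \<in> cone_rel X e \<alpha> \<mu>"
    by (rule Image_singleton_iff[THEN iffD1], rule some_in_quotient[OF eq],
        rule quotientI, rule assms)+
  then have "scaled_dist X \<alpha> \<mu> x y = scaled_dist X \<alpha> \<mu> ?x ?y"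
    by (rule scaled_dist_cong[OF assms(1,2)])
  then show ?thesis
    unfolding asymp_cone_def Metric_space.mdist_metric[OF Metric_space_asymp_cone[OF assms(1-3)]]
    by (rule arg_cong[symmetric])
qed

section \<open>Iterated asymptotic cones\<close>

text \<open>The cone of a metric space over \<^typ>\<open>'a\<close> lives over the larger type
  \<^typ>\<open>(nat \<Rightarrow> 'a) set\<close>, so the iterates do not have a common type. We therefore transport every
  cone isometrically to the type \<open>'a cone_point\<close>, labelling an equivalence class of sequences
  by a chosen representative of it; the labelling is injective on classes (\<open>inj_on_class_label\<close>).
  The zeroth iterate is the copy of the given space under the constructor \<open>Base\<close>.\<close>

definition relabel :: "('a \<Rightarrow> 'b) \<Rightarrow> 'a metric \<Rightarrow> 'b metric" where
  "relabel f X =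
     metric (f ` mspace X, \<lambda>x y. mdist X (inv_into (mspace X) f x) (inv_into (mspace X) f y))"

datatype 'a cone_point = Base 'a | Seq "nat \<Rightarrow> 'a cone_point"

definition class_label :: "(nat \<Rightarrow> 'a cone_point) set \<Rightarrow> 'a cone_point" where
  "class_label A = Seq (SOME x. x \<in> A)"

primrec pointed_iterated_cone ::
    "'a metric \<Rightarrow> 'a \<Rightarrow> (nat \<Rightarrow> real) \<Rightarrow> nat filter \<Rightarrow> nat \<Rightarrow> 'a cone_point metric \<times> 'a cone_point" where
  "pointed_iterated_cone X e \<alpha> \<mu> 0 = (relabel Base X, Base e)"
| "pointed_iterated_cone X e \<alpha> \<mu> (Suc i) =
     (let (C, p) = pointed_iterated_cone X e \<alpha> \<mu> i in
       (relabel class_label (asymp_cone C (\<lambda>_. p) \<alpha> \<mu>),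
        class_label (cone_rel C (\<lambda>_. p) \<alpha> \<mu> `` {\<lambda>_. p})))"

definition iterated_cone ::
    "'a metric \<Rightarrow> 'a \<Rightarrow> (nat \<Rightarrow> real) \<Rightarrow> nat filter \<Rightarrow> nat \<Rightarrow> 'a cone_point metric" where
  "iterated_cone X e \<alpha> \<mu> i = fst (pointed_iterated_cone X e \<alpha> \<mu> i)"

lemma Metric_space_relabel:
  assumes "inj_on f (mspace X)"
  shows "Metric_space (f ` mspace X)
           (\<lambda>x y. mdist X (inv_into (mspace X) f x) (inv_into (mspace X) f y))"
proof
  let ?g = "inv_into (mspace X) f"
  have g: "?g x \<in> mspace X" if "x \<in> f ` mspace X" for x
    using that by (rule inv_into_into)
  show "0 \<le> mdist X (?g x) (?g y)" "mdist X (?g x) (?g y) = mdist X (?g y) (?g x)" for x y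
    by (rule mdist_nonneg, rule mdist_commute)
  show "mdist X (?g x) (?g y) = 0 \<longleftrightarrow> x = y" if "x \<in> f ` mspace X" "y \<in> f ` mspace X" for x y
    using mdist_zero[OF g g, OF that] inv_into_injective[OF _ that] by blast
  show "mdist X (?g x) (?g z) \<le> mdist X (?g x) (?g y) + mdist X (?g y) (?g z)"
    if "x \<in> f ` mspace X" "y \<in> f ` mspace X" "z \<in> f ` mspace X" for x y z
    using that by (intro mdist_triangle g)
qed

lemma mspace_relabel: "inj_on f (mspace X) \<Longrightarrow> mspace (relabel f X) = f ` mspace X"
  unfolding relabel_def by (rule Metric_space.mspace_metric[OF Metric_space_relabel])

lemma mdist_relabel:
  "inj_on f (mspace X) \<Longrightarrow> x \<in> mspace X \<Longrightarrow> y \<in> mspace X \<Longrightarrow>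
     mdist (relabel f X) (f x) (f y) = mdist X x y"
  unfolding relabel_def by (subst Metric_space.mdist_metric[OF Metric_space_relabel]) simp_all

lemma inj_on_class_label:
  assumes "ultrafilter \<mu>" "scaling_factor \<alpha>" "\<And>n. e n \<in> mspace X"
  shows "inj_on class_label (mspace (asymp_cone X e \<alpha> \<mu>))"
proof (rule inj_onI)
  note eq = equiv_cone_rel[OF assms(1,2), of X e]
  fix A B assume "A \<in> mspace (asymp_cone X e \<alpha> \<mu>)" "B \<in> mspace (asymp_cone X e \<alpha> \<mu>)"
    and same: "class_label A = class_label B"
  then have AB: "A \<in> cone_seqs X e \<alpha> \<mu> // cone_rel X e \<alpha> \<mu>"
      "B \<in> cone_seqs X e \<alpha> \<mu> // cone_rel X e \<alpha> \<mu>"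
    by (simp_all add: mspace_asymp_cone[OF assms])
  have "(SOME x. x \<in> A) \<in> A \<inter> B"
    using same some_in_quotient[OF eq AB(1)] some_in_quotient[OF eq AB(2)]
    by (simp add: class_label_def)
  then show "A = B"
    using quotient_disj[OF eq AB] by blast
qed

lemma basepoint_in_iterated_cone:
  assumes "ultrafilter \<mu>" "scaling_factor \<alpha>" "e \<in> mspace X"
  shows "snd (pointed_iterated_cone X e \<alpha> \<mu> i) \<in> mspace (iterated_cone X e \<alpha> \<mu> i)"
proof (induction i)
  case 0
  have "inj_on Base (mspace X)"
    by (auto intro: inj_onI)
  then show ?case
    using assms by (simp add: iterated_cone_def mspace_relabel)
next
  case (Suc i)
  obtain C p where Cp: "pointed_iterated_cone X e \<alpha> \<mu> i = (C, p)"
    by fastforce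
  then have p: "p \<in> mspace C"
    using Suc by (simp add: iterated_cone_def)
  then have "(\<lambda>_. p) \<in> cone_seqs C (\<lambda>_. p) \<alpha> \<mu>"
    using assms by (simp add: cone_seqs_def scaled_dist_self)
  then have "cone_rel C (\<lambda>_. p) \<alpha> \<mu> `` {\<lambda>_. p} \<in> mspace (asymp_cone C (\<lambda>_. p) \<alpha> \<mu>)"
    using mspace_asymp_cone[OF assms(1,2), of "\<lambda>_. p" C] p by (simp add: quotientI)
  then show ?case
    using mspace_relabel[OF inj_on_class_label[OF assms(1,2), of "\<lambda>_. p" C]] p Cp
    by (simp add: iterated_cone_def)
qed

end

(* The spaces Y_0, Y_1, ... are closed subsets of the half-line, and Y_i depends only on i mod m.
   Each Y_i consists of 0, a marker in [1,2] with exactly i mod m accumulation points, and a locally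
   finite set far away that carries, near the scale alpha_n = 2^(4^n), a finite approximation of
   alpha_n * Y_(i+1) which becomes exact as n tends to infinity. The scales grow so fast that
   Y_i / alpha_n converges to Y_(i+1) locally in the Hausdorff sense, so for every ultrafilter the
   cone of Y_i is isometric to Y_(i+1). The approximations being finite, Y_i has no accumulation
   points besides those of its marker, and the number of accumulation points recovers i mod m. *)

theory Submission
  imports Defs
begin

section \<open>Pointed isometric copies of subsets of the half-line\<close>

text \<open>The distance to \<open>p\<close> is an isometry of \<open>X\<close> onto
  \<open>S\<close>, with \<open>p\<close> corresponding to \<open>0\<close>. In this form the
  iterated cones can be compared with sets of reals, whatever their points are.\<close>

definition ray_model :: "'a metric \<Rightarrow> 'a \<Rightarrow> real set \<Rightarrow> bool" where
  "ray_model X p S \<longleftrightarrow> p \<in> mspace X \<and> (\<lambda>x. mdist X x p) ` mspace X = S \<and>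
     (\<forall>x\<in>mspace X. \<forall>y\<in>mspace X. mdist X x y = \<bar>mdist X x p - mdist X y p\<bar>)"

lemma ray_model_submetric_euclidean:
  assumes "0 \<in> S" "S \<subseteq> {0..}"
  shows "ray_model (submetric euclidean_metric S) 0 S"
  using assms by (force simp: ray_model_def dist_real_def subset_iff)

lemma ray_model_relabel:
  assumes "ray_model X p S" "inj_on f (mspace X)"
  shows "ray_model (relabel f X) (f p) S"
proof -
  have p: "p \<in> mspace X" and im: "(\<lambda>x. mdist X x p) ` mspace X = S"
    and eq: "\<And>x y. x \<in> mspace X \<Longrightarrow> y \<in> mspace X \<Longrightarrow> mdist X x y = \<bar>mdist X x p - mdist X y p\<bar>"
    using assms(1) unfolding ray_model_def by blast+
  show ?thesis
    unfolding ray_model_def mspace_relabel[OF assms(2)]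
    using p im by (simp add: mdist_relabel[OF assms(2)] image_image eq[symmetric])
qed

lemma ray_model_homeomorphic:
  assumes "ray_model X p S"
  shows "mtopology_of X homeomorphic_space top_of_set S"
proof -
  let ?d = "\<lambda>x. mdist X x p"
  interpret M: Metric_space12 "mspace X" "mdist X" S dist
    by (intro Metric_space12.intro Metric_space_mspace_mdist) (rule Met_TC.subspace, simp)
  have "?d ` mspace X = S"
    and "\<And>x y. x \<in> mspace X \<Longrightarrow> y \<in> mspace X \<Longrightarrow> dist (?d x) (?d y) = mdist X x y"
    using assms unfolding ray_model_def dist_real_def by metis+
  then have "homeomorphic_map M.M1.mtopology M.M2.mtopology ?d"
    by (rule M.isometry_imp_homeomorphic_map)
  moreover have "M.M2.mtopology = top_of_set S"
    using mtopology_of_submetric[of "euclidean_metric :: real metric" S]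
    by (simp add: submetric_def)
  ultimately show ?thesis
    by (simp add: mtopology_of_def homeomorphic_map_imp_homeomorphic_space)
qed

section \<open>Cones along non-principal ultrafilters\<close>

text \<open>An ultrafilter containing a singleton is principal, so a non-principal one contains all
  cofinite sets. Hence ordinary limits of sequences are also limits along \<mu>.\<close>

lemma nonprincipal_ultrafilter_le_sequentially:
  assumes "nonprincipal_ultrafilter \<mu>"
  shows "\<mu> \<le> sequentially"
proof (rule filter_leI)
  have nb: "\<mu> \<noteq> bot" and ult: "\<And>P. eventually P \<mu> \<or> eventually (\<lambda>n. \<not> P n) \<mu>"
    using assms by (auto simp: nonprincipal_ultrafilter_def ultrafilter_def)
  have ne: "eventually (\<lambda>n. n \<noteq> k) \<mu>" for k
  proof (rule ccontr)
    assume "\<not> eventually (\<lambda>n. n \<noteq> k) \<mu>"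
    then have k: "eventually (\<lambda>n. n = k) \<mu>"
      using ult[of "\<lambda>n. n \<noteq> k"] by simp
    have "eventually P \<mu> \<longleftrightarrow> P k" for P
    proof
      assume "eventually P \<mu>"
      with k have "eventually (\<lambda>n. P k) \<mu>"
        by eventually_elim simp
      then show "P k"
        using nb by (simp add: eventually_const_iff)
    next
      assume "P k"
      with k show "eventually P \<mu>"
        by (auto elim: eventually_mono)
    qed
    then have "\<mu> = principal {k}"
      by (simp add: filter_eq_iff eventually_principal)
    then show False
      using assms by (auto simp: nonprincipal_ultrafilter_def)
  qed
  fix P assume "eventually P sequentially"
  then obtain N where N: "\<And>n. n \<ge> N \<Longrightarrow> P n"
    by (auto simp: eventually_sequentially)
  have "eventually (\<lambda>n. \<forall>k\<in>{..<N}. n \<noteq> k) \<mu>"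
    by (intro eventually_ball_finite ballI ne) simp
  then show "eventually P \<mu>"
    by eventually_elim (metis N lessThan_iff not_le_imp_less)
qed

text \<open>Distances in \<open>C\<close> are differences of distances to \<open>p\<close>, so a
  class in the cone is determined by the limit of its rescaled distances to \<open>p\<close>. The
  cone is therefore the set of these limits: \<open>lower\<close> realizes every element of
  \<open>T\<close>, and \<open>upper\<close> excludes all other values.\<close>

lemma ray_model_asymp_cone:
  assumes \<mu>: "nonprincipal_ultrafilter \<mu>" and \<alpha>: "scaling_factor \<alpha>" and C: "ray_model C p S"
    and lower: "\<And>t. t \<in> T \<Longrightarrow> \<exists>s. (\<forall>n. s n \<in> S) \<and> (\<lambda>n. s n / \<alpha> n) \<longlonglongrightarrow> t"
    and upper: "\<And>s t. (\<And>n. s n \<in> S) \<Longrightarrow> ((\<lambda>n. s n / \<alpha> n) \<longlongrightarrow> t) \<mu> \<Longrightarrow> t \<in> T"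
  shows "ray_model (asymp_cone C (\<lambda>_. p) \<alpha> \<mu>) (cone_rel C (\<lambda>_. p) \<alpha> \<mu> `` {\<lambda>_. p}) T"
proof -
  let ?e = "\<lambda>_ :: nat. p" and ?d = "\<lambda>x. mdist C x p"
  let ?S = "cone_seqs C ?e \<alpha> \<mu>" and ?r = "cone_rel C ?e \<alpha> \<mu>" and ?K = "asymp_cone C ?e \<alpha> \<mu>"
  define r where "r x = enn2real (scaled_dist C \<alpha> \<mu> x ?e)" for x
  have uf: "ultrafilter \<mu>" and nb: "\<mu> \<noteq> bot"
    using \<mu> by (auto simp: nonprincipal_ultrafilter_def ultrafilter_def)
  have pos: "\<alpha> n > 0" for n
    using \<alpha> by (simp add: scaling_factor_def)
  have p: "p \<in> mspace C" and im: "?d ` mspace C = S"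
    and eq: "\<And>x y. x \<in> mspace C \<Longrightarrow> y \<in> mspace C \<Longrightarrow> mdist C x y = \<bar>?d x - ?d y\<bar>"
    using C unfolding ray_model_def by blast+
  have eS: "?e \<in> ?S"
    using p uf by (simp add: cone_seqs_def scaled_dist_self)
  \<comment> \<open>On \<open>?S\<close> the ultralimit is finite, so the limit in
    \<open>ennreal\<close> becomes a limit of reals.\<close>
  have lim: "((\<lambda>n. ?d (x n) / \<alpha> n) \<longlongrightarrow> r x) \<mu>" if "x \<in> ?S" for x
  proof -
    have "Lim \<mu> (\<lambda>n. ennreal (?d (x n) / \<alpha> n)) = ennreal (r x)"
      using that by (simp add: r_def cone_seqs_def scaled_dist_def)
    then have "((\<lambda>n. ennreal (?d (x n) / \<alpha> n)) \<longlongrightarrow> ennreal (r x)) \<mu>"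
      using ultrafilter_tendsto_Lim[OF uf] by metis
    then have "((\<lambda>n. enn2real (ennreal (?d (x n) / \<alpha> n))) \<longlongrightarrow> r x) \<mu>"
      by (rule tendsto_enn2real) (simp add: r_def)
    then show ?thesis
      using pos by (simp add: less_imp_le)
  qed
  have sd: "scaled_dist C \<alpha> \<mu> x y = ennreal \<bar>r x - r y\<bar>" if "x \<in> ?S" "y \<in> ?S" for x y
  proof -
    have "((\<lambda>n. ennreal \<bar>?d (x n) / \<alpha> n - ?d (y n) / \<alpha> n\<bar>) \<longlongrightarrow> ennreal \<bar>r x - r y\<bar>) \<mu>"
      by (intro tendsto_intros lim that)
    also have "(\<lambda>n. ennreal \<bar>?d (x n) / \<alpha> n - ?d (y n) / \<alpha> n\<bar>) = (\<lambda>n. ennreal (mdist C (x n) (y n) / \<alpha> n))"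
      using that pos by (auto simp: eq[symmetric] cone_seqs_def diff_divide_distrib[symmetric] less_imp_le)
    finally show ?thesis
      unfolding scaled_dist_def by (rule tendsto_Lim[OF nb])
  qed
  have md: "mdist ?K (?r `` {x}) (?r `` {y}) = \<bar>r x - r y\<bar>" if "x \<in> ?S" "y \<in> ?S" for x y
    using that by (simp add: mdist_asymp_cone[OF uf \<alpha>] p sd)
  have re: "r ?e = 0"
    using p uf by (simp add: r_def scaled_dist_self)
  have r0: "r x \<ge> 0" for x
    by (simp add: r_def)
  have ms: "mspace ?K = (\<lambda>x. ?r `` {x}) ` ?S"
    using mspace_asymp_cone[OF uf \<alpha>, of ?e C] p by (auto simp: quotient_def)
  have "r ` ?S = T"
  proof (intro equalityI subsetI)
    fix t assume "t \<in> r ` ?S"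
    then obtain x where x: "x \<in> ?S" "t = r x" by auto
    then show "t \<in> T"
      using lim[OF x(1)] im by (intro upper[of "\<lambda>n. ?d (x n)"]) (auto simp: cone_seqs_def)
  next
    fix t assume "t \<in> T"
    from lower[OF this] obtain s where s: "\<And>n. s n \<in> S" "(\<lambda>n. s n / \<alpha> n) \<longlonglongrightarrow> t"
      by auto
    \<comment> \<open>Every element of \<open>S\<close> is the distance of some point of
      \<open>C\<close> to \<open>p\<close>, so the sequence of reals lifts to
      \<open>C\<close>.\<close>
    have "\<forall>n. \<exists>x. x \<in> mspace C \<and> ?d x = s n"
      using s(1) unfolding im[symmetric] image_iff by metis
    then obtain x where x: "\<And>n. x n \<in> mspace C" "\<And>n. ?d (x n) = s n"
      by metis
    have st: "((\<lambda>n. s n / \<alpha> n) \<longlongrightarrow> t) \<mu>"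
      using s(2) nonprincipal_ultrafilter_le_sequentially[OF \<mu>] by (rule tendsto_mono[rotated])
    have "t \<ge> 0"
      by (rule tendsto_lowerbound[OF st _ nb]) (simp add: x(2)[symmetric] pos less_imp_le)
    have "scaled_dist C \<alpha> \<mu> x ?e = ennreal t"
      unfolding scaled_dist_def x(2) by (intro tendsto_Lim nb tendsto_ennrealI st)
    then have "x \<in> ?S" "r x = t"
      using x(1) \<open>t \<ge> 0\<close> by (auto simp: cone_seqs_def r_def)
    then show "t \<in> r ` ?S" by auto
  qed
  then show ?thesis
    unfolding ray_model_def ms using eS by (auto simp: md re r0 image_image)
qed

text \<open>Each passage to the cone advances the index of \<open>Y\<close> by one, and the class of
  the constant sequence at the basepoint again corresponds to \<open>0\<close>.\<close>

lemma ray_model_iterated_cone: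
  assumes \<mu>: "nonprincipal_ultrafilter \<mu>" and \<alpha>: "scaling_factor \<alpha>" and X: "ray_model X e (Y 0)"
    and lower: "\<And>i t. t \<in> Y (Suc i) \<Longrightarrow> \<exists>s. (\<forall>n. s n \<in> Y i) \<and> (\<lambda>n. s n / \<alpha> n) \<longlonglongrightarrow> t"
    and upper: "\<And>i s t. (\<And>n. s n \<in> Y i) \<Longrightarrow> ((\<lambda>n. s n / \<alpha> n) \<longlongrightarrow> t) \<mu> \<Longrightarrow> t \<in> Y (Suc i)"
  shows "ray_model (iterated_cone X e \<alpha> \<mu> i) (snd (pointed_iterated_cone X e \<alpha> \<mu> i)) (Y i)"
proof (induction i)
  case 0
  show ?case
    using ray_model_relabel[OF X, of Base] by (simp add: iterated_cone_def inj_on_def)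
next
  case (Suc i)
  obtain C p where Cp: "pointed_iterated_cone X e \<alpha> \<mu> i = (C, p)"
    by fastforce
  have C: "ray_model C p (Y i)"
    using Suc Cp by (simp add: iterated_cone_def)
  have uf: "ultrafilter \<mu>"
    using \<mu> by (simp add: nonprincipal_ultrafilter_def)
  have p: "p \<in> mspace C"
    using C unfolding ray_model_def by blast
  have "ray_model (asymp_cone C (\<lambda>_. p) \<alpha> \<mu>) (cone_rel C (\<lambda>_. p) \<alpha> \<mu> `` {\<lambda>_. p}) (Y (Suc i))"
    using \<mu> \<alpha> C lower upper by (rule ray_model_asymp_cone)
  from ray_model_relabel[OF this inj_on_class_label[OF uf \<alpha> p]] show ?case
    by (simp add: iterated_cone_def Cp)
qed

section \<open>Accumulation points as a topological invariant\<close>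

text \<open>This count is the invariant that separates cones whose indices have different
  residues.\<close>

lemma homeomorphic_space_derived_set_card:
  assumes "X homeomorphic_space Y"
  shows "card (X derived_set_of topspace X) = card (Y derived_set_of topspace Y)"
proof -
  obtain f where f: "homeomorphic_map X Y f"
    using assms by (auto simp: homeomorphic_space)
  have "Y derived_set_of topspace Y = f ` (X derived_set_of topspace X)"
    using homeomorphic_map_derived_set_of[OF f, of "topspace X"] homeomorphic_imp_surjective_map[OF f]
    by simp
  moreover have "inj_on f (X derived_set_of topspace X)"
    using homeomorphic_imp_injective_map[OF f] derived_set_of_subset_topspace by (rule inj_on_subset)
  ultimately show ?thesis
    by (simp add: card_image)
qed

text \<open>A closed set contains its limit points, so accumulation points of the subspace may be
  computed in the ambient space.\<close>

lemma derived_set_of_top_of_closed: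
  fixes S :: "'a::topological_space set"
  assumes "closed S"
  shows "top_of_set S derived_set_of S = {x. x islimpt S}"
proof -
  have "euclidean derived_set_of S = {x. x islimpt S}"
    unfolding derived_set_of_def islimpt_def open_openin[symmetric] topspace_euclidean by blast
  then show ?thesis
    using assms by (auto simp: derived_set_of_subtopology closed_limpt)
qed

section \<open>The scales\<close>

text \<open>Each scale is the fourth power of the preceding one. Level \<open>n\<close> of a model
  will reach up to at most \<open>radius n ^ 2\<close>, and even the square of that bound does not
  exceed the next scale.\<close>

definition radius :: "nat \<Rightarrow> real" where
  "radius n = 2 ^ (4 ^ n)"

lemma radius_ge_2: "2 \<le> radius n"
  using power_increasing[of 1 "4 ^ n" "2::real"] by (simp add: radius_def)

lemma radius_pos: "0 < radius n"
  using radius_ge_2[of n] by linarith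

lemma radius_power_4_le:
  assumes "k < n"
  shows "radius k ^ 4 \<le> radius n"
proof -
  have "4 * 4 ^ k \<le> (4 ^ n :: nat)"
    using power_increasing[of "Suc k" n "4::nat"] assms by simp
  then show ?thesis
    by (simp add: radius_def power_mult[symmetric] mult.commute)
qed

lemma radius_power_2_le:
  assumes "k < n"
  shows "radius k ^ 2 \<le> radius n"
  using power_increasing[of 2 4 "radius k"] radius_power_4_le[OF assms] radius_ge_2[of k] by linarith

lemma filterlim_radius: "filterlim radius at_top sequentially"
proof (rule filterlim_at_top_mono[OF filterlim_real_sequentially], intro always_eventually allI)
  fix n
  have "n < 4 ^ n" "(4 ^ n :: nat) < 2 ^ (4 ^ n)"
    by (rule power_gt_expt, simp)+
  then have "n \<le> 2 ^ (4 ^ n)"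
    by linarith
  then have "real n \<le> real (2 ^ (4 ^ n))"
    by (simp only: of_nat_le_iff)
  then show "real n \<le> radius n"
    by (simp add: radius_def)
qed

lemma scaling_factor_radius: "scaling_factor radius"
  by (simp add: scaling_factor_def radius_pos filterlim_radius)

section \<open>Markers and model spaces\<close>

text \<open>For \<open>m > 0\<close> and fixed \<open>j\<close> this sequence decreases strictly to
  \<open>cluster_point m j\<close>, starting from \<open>cluster_point m (Suc j)\<close>.\<close>

definition cluster :: "nat \<Rightarrow> nat \<Rightarrow> nat \<Rightarrow> real" where
  "cluster m j k = 1 + (real j + 1 / real (Suc k)) / real m"

definition cluster_point :: "nat \<Rightarrow> nat \<Rightarrow> real" where
  "cluster_point m j = 1 + real j / real m"

definition marker :: "nat \<Rightarrow> nat \<Rightarrow> real set" where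
  "marker m i = (\<Union>j<i mod m. insert (cluster_point m j) (range (cluster m j)))"

text \<open>Finite truncations keep the dilated copies of the marker free of accumulation points; as
  \<open>n\<close> grows they exhaust the sequences, and the limit points return in the
  limit.\<close>

definition marker_net :: "nat \<Rightarrow> nat \<Rightarrow> nat \<Rightarrow> real set" where
  "marker_net m i n = (\<Union>j<i mod m. cluster m j ` {..n})"

text \<open>The points of the \<open>i\<close>-th space with leading scale \<^term>\<open>radius n\<close>: a copy, dilated by
  \<^term>\<open>radius n\<close>, of the bounded part of the next space, with its marker replaced by the finite
  net.\<close>

inductive far :: "nat \<Rightarrow> nat \<Rightarrow> nat \<Rightarrow> real \<Rightarrow> bool" for m where
  far_net: "x \<in> marker_net m (Suc i) n \<Longrightarrow> far m i n (radius n * x)"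
| far_far: "far m (Suc i) k x \<Longrightarrow> k < n \<Longrightarrow> far m i n (radius n * x)"

definition model :: "nat \<Rightarrow> nat \<Rightarrow> real set" where
  "model m i = insert 0 (marker m i) \<union> {x. \<exists>n. far m i n x}"

lemma marker_net_subset: "marker_net m i n \<subseteq> marker m i"
  by (auto simp: marker_net_def marker_def)

lemma marker_subset: "marker m i \<subseteq> {1..2}"
proof
  fix x assume "x \<in> marker m i"
  then obtain j where j: "j < i mod m" and x: "x = cluster_point m j \<or> (\<exists>k. x = cluster m j k)"
    by (auto simp: marker_def)
  \<comment> \<open>For \<open>m = 0\<close> the division by zero gives \<open>0\<close>, so that
    \<open>x\<close> is \<open>1\<close>.\<close>
  have jm: "m = 0 \<or> real j + 1 \<le> real m"
    using j mod_less_divisor[of m i] by (cases "m = 0") (simp, linarith)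
  from x obtain e where e: "x = 1 + (real j + e) / real m" "0 \<le> e" "e \<le> 1"
    by (force simp: cluster_point_def cluster_def)
  then show "x \<in> {1..2}"
    using jm by (auto simp: divide_le_eq)
qed

lemma cluster_tendsto: "cluster m j \<longlonglongrightarrow> cluster_point m j"
proof -
  have "(\<lambda>k. 1 + (real j + inverse (real (Suc k))) / real m) \<longlonglongrightarrow> 1 + (real j + 0) / real m"
    unfolding divide_inverse[of _ "real m"] by (intro tendsto_intros LIMSEQ_inverse_real_of_nat)
  then show ?thesis
    by (simp add: cluster_def[abs_def] cluster_point_def inverse_eq_divide)
qed

lemma islimpt_cluster:
  assumes "m > 0"
  shows "x islimpt range (cluster m j) \<longleftrightarrow> x = cluster_point m j"
proof
  assume "x islimpt range (cluster m j)"
  then show "x = cluster_point m j"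
    by (rule sequence_unique_limpt[OF cluster_tendsto])
next
  assume "x = cluster_point m j"
  moreover have "cluster m j k \<noteq> cluster_point m j" for k
    using assms by (simp add: cluster_def cluster_point_def)
  ultimately show "x islimpt range (cluster m j)"
    using cluster_tendsto unfolding islimpt_sequential by blast
qed

lemma islimpt_marker:
  assumes "m > 0"
  shows "x islimpt marker m i \<longleftrightarrow> x \<in> cluster_point m ` {..<i mod m}"
proof -
  \<comment> \<open>The number of sequences becomes a free \<open>N\<close> for the induction; a
    finite union accumulates only where one of its members does.\<close>
  have "x islimpt (\<Union>j<N. insert (cluster_point m j) (range (cluster m j)))
      \<longleftrightarrow> x \<in> cluster_point m ` {..<N}" for N
    by (induction N) (auto simp: lessThan_Suc islimpt_Un islimpt_insert islimpt_cluster[OF assms])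
  then show ?thesis
    by (simp add: marker_def)
qed

section \<open>Levels and accumulation points of the models\<close>

text \<open>The factor multiplying \<open>radius n\<close> lies between \<open>1\<close> and
  \<open>radius n\<close>: a net point is in \<open>[1,2]\<close>, and a point of level
  \<open>k < n\<close> is at most \<open>radius k ^ 2\<close>, hence at most
  \<open>radius n\<close>.\<close>

lemma far_bounds:
  assumes "far m i n x"
  shows "radius n \<le> x" "x \<le> radius n ^ 2"
proof -
  have "radius n \<le> x \<and> x \<le> radius n ^ 2"
    using assms
  proof induction
    case (far_net x i n)
    then have "x \<in> {1..2}"
      using marker_net_subset marker_subset by blast
    then show ?case
      using radius_ge_2[of n] by (auto simp: power2_eq_square mult_left_mono)
  next
    case (far_far i k x n)
    then show ?case
      using radius_ge_2[of n] radius_ge_2[of k] radius_power_2_le[of k n]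
      by (auto simp: power2_eq_square mult_left_mono)
  qed
  then show "radius n \<le> x" "x \<le> radius n ^ 2" by auto
qed

text \<open>Level \<open>n\<close> is a dilation of a finite net and of finitely many lower levels
  of the next model; \<open>i\<close> is arbitrary because the recursion raises it.\<close>

lemma finite_far: "finite {x. far m i n x}"
proof (induction n arbitrary: i rule: less_induct)
  case (less n)
  have "{x. far m i n x} \<subseteq> (*) (radius n) ` (marker_net m (Suc i) n \<union> (\<Union>k<n. {x. far m (Suc i) k x}))"
    by (force elim: far.cases)
  moreover have "finite \<dots>"
    using less by (auto simp: marker_net_def)
  ultimately show ?case
    by (rule finite_subset)
qed

text \<open>Level \<open>n\<close> starts at \<open>radius n\<close> or later, so a ball meets only
  finitely many levels, each of them finite.\<close>

lemma not_islimpt_far: "\<not> x islimpt {x. \<exists>n. far m i n x}"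
proof -
  obtain N where N: "radius n > x + 1" if "n \<ge> N" for n
    using filterlim_radius by (auto simp: filterlim_at_top_dense eventually_sequentially)
  have "{x. \<exists>n. far m i n x} \<inter> ball x 1 \<subseteq> (\<Union>n<N. {x. far m i n x})"
  proof
    fix y assume "y \<in> {x. \<exists>n. far m i n x} \<inter> ball x 1"
    then obtain n where n: "far m i n y" and "y < x + 1"
      by (auto simp: dist_real_def)
    then have "n < N"
      using N[of n] far_bounds(1)[OF n] by (meson leI less_imp_le not_le order_trans)
    then show "y \<in> (\<Union>n<N. {x. far m i n x})"
      using n by auto
  qed
  then have "finite ({x. \<exists>n. far m i n x} \<inter> ball x 1)"
    by (rule finite_subset) (simp add: finite_far)
  then show ?thesis
    unfolding islimpt_eq_infinite_ball by (metis zero_less_one)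
qed

lemma islimpt_model:
  assumes "m > 0"
  shows "x islimpt model m i \<longleftrightarrow> x \<in> cluster_point m ` {..<i mod m}"
  by (simp add: model_def islimpt_Un islimpt_insert not_islimpt_far islimpt_marker assms)

lemma closed_model:
  assumes "m > 0"
  shows "closed (model m i)"
  unfolding closed_limpt islimpt_model[OF assms] by (auto simp: model_def marker_def)

lemma card_derived_set_model:
  assumes "m > 0"
  shows "card (top_of_set (model m i) derived_set_of model m i) = i mod m"
proof -
  have "top_of_set (model m i) derived_set_of model m i = cluster_point m ` {..<i mod m}"
    by (simp add: derived_set_of_top_of_closed closed_model islimpt_model assms)
  moreover have "inj (cluster_point m)"
    using assms by (simp add: inj_def cluster_point_def)
  ultimately show ?thesis
    by (simp add: card_image inj_on_subset)
qed

text \<open>The index enters only through the markers of \<open>i\<close>, \<open>Suc i\<close> and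
  so on, and congruence is preserved by successors.\<close>

lemma model_cong:
  assumes "i mod m = i' mod m"
  shows "model m i = model m i'"
proof -
  have far: "far m i' n x" if "far m i n x" "i mod m = i' mod m" for i i' n x
    using that
  proof (induction arbitrary: i')
    case (far_net x i n)
    have "Suc i mod m = Suc i' mod m"
      using far_net.prems by (metis mod_Suc_eq)
    then have "x \<in> marker_net m (Suc i') n"
      using far_net.hyps by (simp add: marker_net_def)
    then show ?case
      by (rule far.far_net)
  next
    case (far_far i k x n)
    have "Suc i mod m = Suc i' mod m"
      using far_far.prems by (metis mod_Suc_eq)
    then have "far m (Suc i') k x"
      by (rule far_far.IH)
    then show ?case
      using far_far.hyps(2) by (rule far.far_far)
  qed
  have "far m i n x \<longleftrightarrow> far m i' n x" for n x
    using far[of i n x i'] far[of i' n x i] assms by argo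
  then show ?thesis
    by (simp add: model_def marker_def assms)
qed

lemma model_nonneg: "model m i \<subseteq> {0..}"
proof
  fix x assume "x \<in> model m i"
  then consider "x = 0" | "x \<in> marker m i" | n where "far m i n x"
    by (auto simp: model_def)
  then show "x \<in> {0..}"
  proof cases
    case 2
    then show ?thesis
      using marker_subset[of m i] by auto
  next
    case 3
    then show ?thesis
      using far_bounds(1)[OF 3] radius_pos[of n] by simp
  qed simp
qed

section \<open>Rescaled limits of the models\<close>

text \<open>A nonzero point of the next model is approximated, or eventually attained, by points of
  level \<open>n\<close> divided by \<open>radius n\<close>.\<close>

lemma model_scaled_lower:
  assumes "t \<in> model m (Suc i)"
  shows "\<exists>s. (\<forall>n. s n \<in> model m i) \<and> (\<lambda>n. s n / radius n) \<longlonglongrightarrow> t"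
proof -
  have *: ?thesis if x: "x \<longlonglongrightarrow> t" and ev: "eventually (\<lambda>n. far m i n (radius n * x n)) sequentially" for x
  proof -
    \<comment> \<open>The default \<open>0\<close> belongs to every model and is used at most
      finitely often.\<close>
    define s where "s n = (if far m i n (radius n * x n) then radius n * x n else 0)" for n
    have "eventually (\<lambda>n. x n = s n / radius n) sequentially"
      using ev by eventually_elim (use radius_pos in \<open>simp add: s_def less_imp_neq[symmetric]\<close>)
    then have "(\<lambda>n. s n / radius n) \<longlonglongrightarrow> t"
      using x by (rule Lim_transform_eventually[rotated])
    moreover have "s n \<in> model m i" for n
      by (auto simp: s_def model_def)
    ultimately show ?thesis by blast
  qed
  consider "t = 0" | j where "j < Suc i mod m" "t = cluster_point m j"
    | j k where "j < Suc i mod m" "t = cluster m j k" | k where "far m (Suc i) k t"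
    using assms by (auto simp: model_def marker_def)
  then show ?thesis
  proof cases
    case 1
    then show ?thesis
      by (intro exI[of _ "\<lambda>_. 0"]) (simp add: model_def)
  next
    case 2
    \<comment> \<open>The approximant is \<open>cluster m j n\<close>, the last term that the
      \<open>n\<close>-th net takes from this sequence.\<close>
    then show ?thesis
      using cluster_tendsto[of m j]
      by (intro *[of "cluster m j"] always_eventually allI far_net) (force simp: marker_net_def)+
  next
    case 3
    then show ?thesis
      by (intro *[of "\<lambda>_. t"] eventually_sequentiallyI[of k] far_net) (auto simp: marker_net_def)
  next
    case 4
    \<comment> \<open>Level \<open>k\<close> is copied only into levels above it, hence the start at
      \<open>Suc k\<close>.\<close>
    then show ?thesis
      by (intro *[of "\<lambda>_. t"] eventually_sequentiallyI[of "Suc k"] far_far) auto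
  qed
qed

text \<open>Within the window from \<open>c\<close> to \<open>1 / c\<close> the rescaled model sees
  level \<open>n\<close> only: lower levels have shrunk below \<open>c\<close>, higher ones exceed
  \<open>1 / c\<close>. Level \<open>n\<close> divided by \<open>radius n\<close> lies in the next
  model exactly.\<close>

lemma model_div_radius:
  assumes x: "x \<in> model m i" and c: "0 < c" "c < x / radius n" "x / radius n < 1 / c"
    and n: "2 / c ^ 2 < radius n"
  shows "x / radius n \<in> model m (Suc i)"
proof -
  have pos: "0 < radius n"
    by (rule radius_pos)
  have cx: "c * radius n < x" and xc: "c * x < radius n"
    using c pos by (simp_all add: field_simps)
  have "c < 1 / c"
    using c by linarith
  then have "c * c < 1"
    using c(1) by (simp add: field_simps)
  then have c1: "c < 1"
    using c(1) by (smt (verit) mult_le_cancel_left1)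
  have n2: "2 < c\<^sup>2 * radius n"
    using n c(1) by (simp add: field_simps)
  have "c\<^sup>2 * radius n \<le> c * radius n"
    using c1 c(1) pos by (simp add: power2_eq_square)
  \<comment> \<open>This excludes \<open>0\<close> and the marker, so that \<open>x\<close> belongs
    to some level.\<close>
  then have "2 < x"
    using cx n2 by linarith
  then have "x \<noteq> 0" "x \<notin> marker m i"
    using marker_subset[of m i] by auto
  then obtain k where k: "far m i k x"
    using x by (auto simp: model_def)
  consider "k < n" | "n < k" | "k = n"
    by linarith
  then show ?thesis
  proof cases
    case 1
    \<comment> \<open>A lower level would give \<open>x ^ 2\<close> at most \<open>radius n\<close>,
      whereas \<open>x\<close> exceeds \<open>c * radius n\<close>.\<close>
    have "(c * radius n)\<^sup>2 \<le> (radius k ^ 2)\<^sup>2"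
      using cx far_bounds(2)[OF k] c(1) pos by (intro power_mono) auto
    also have "\<dots> \<le> radius n"
      using radius_power_4_le[OF 1] by simp
    finally have "c\<^sup>2 * radius n \<le> 1"
      using pos by (simp add: power2_eq_square)
    then show ?thesis
      using n2 by linarith
  next
    case 2
    have "radius n ^ 2 \<le> x"
      using radius_power_2_le[OF 2] far_bounds(1)[OF k] by linarith
    then have "c * radius n ^ 2 < radius n"
      using xc c(1) by (smt (verit) mult_left_mono)
    then have "c * radius n < 1"
      using pos by (simp add: power2_eq_square)
    then show ?thesis
      using n2 \<open>c\<^sup>2 * radius n \<le> c * radius n\<close> by linarith
  next
    case 3
    have "\<exists>y. x = radius n * y \<and> y \<in> model m (Suc i)"
      using k marker_net_subset[of m "Suc i" n] unfolding 3
      by cases (auto simp: model_def)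
    then show ?thesis
      using pos by auto
  qed
qed

text \<open>A positive limit has a window around it in which the rescaled points eventually belong
  to the next model, and that model is closed. Points collapsing to the origin are covered by
  \<open>0\<close>.\<close>

lemma model_scaled_upper:
  assumes m: "m > 0" and \<mu>: "nonprincipal_ultrafilter \<mu>"
    and s: "\<And>n. s n \<in> model m i" and lim: "((\<lambda>n. s n / radius n) \<longlongrightarrow> t) \<mu>"
  shows "t \<in> model m (Suc i)"
proof (cases "t = 0")
  case True
  then show ?thesis by (simp add: model_def)
next
  case False
  have nb: "\<mu> \<noteq> bot"
    using \<mu> by (simp add: nonprincipal_ultrafilter_def ultrafilter_def)
  have "t \<ge> 0"
  proof (rule tendsto_lowerbound[OF lim _ nb], intro always_eventually allI)
    fix n
    have "s n \<ge> 0"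
      using s[of n] model_nonneg[of m i] by auto
    then show "0 \<le> s n / radius n"
      using radius_pos[of n] by simp
  qed
  then have t: "t > 0"
    using False by simp
  \<comment> \<open>Both terms of the minimum leave a factor \<open>2\<close>, so \<open>t\<close>
    lies strictly between \<open>c\<close> and \<open>1 / c\<close>.\<close>
  define c where "c = min (t / 2) (1 / (2 * t))"
  have c: "0 < c" "c < t" "t < 1 / c"
    using t by (auto simp: c_def min_def field_simps)
  have "eventually (\<lambda>n. 2 / c ^ 2 < radius n) \<mu>"
    using filterlim_mono[OF filterlim_radius order_refl nonprincipal_ultrafilter_le_sequentially[OF \<mu>]]
    by (simp add: filterlim_at_top_dense)
  with order_tendstoD(1)[OF lim c(2)] order_tendstoD(2)[OF lim c(3)]
  have "eventually (\<lambda>n. s n / radius n \<in> model m (Suc i)) \<mu>"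
    by eventually_elim (rule model_div_radius[OF s c(1)])
  then show ?thesis
    by (rule Lim_in_closed_set[OF closed_model[OF m] _ nb lim])
qed

section \<open>Classification of the iterated cones\<close>

theorem theorem4p4:
  fixes m :: nat
  assumes "m > 0"
  shows "\<exists>(X :: real metric) e \<alpha>. e \<in> mspace X \<and> scaling_factor \<alpha> \<and>
           (\<forall>\<mu> :: nat filter. nonprincipal_ultrafilter \<mu> \<longrightarrow>
             (\<forall>i j :: nat.
               mtopology_of (iterated_cone X e \<alpha> \<mu> i) homeomorphic_space
                 mtopology_of (iterated_cone X e \<alpha> \<mu> j) \<longleftrightarrow> [i = j] (mod m)))"
proof -
  \<comment> \<open>The space and the scales are fixed before the ultrafilter is chosen.\<close>
  let ?X = "submetric euclidean_metric (model m 0)"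
  have X: "ray_model ?X 0 (model m 0)"
    using model_nonneg by (intro ray_model_submetric_euclidean) (auto simp: model_def)
  have "mtopology_of (iterated_cone ?X 0 radius \<mu> i) homeomorphic_space
      mtopology_of (iterated_cone ?X 0 radius \<mu> j) \<longleftrightarrow> [i = j] (mod m)"
    if \<mu>: "nonprincipal_ultrafilter \<mu>" for \<mu> i j
  proof -
    have cone: "mtopology_of (iterated_cone ?X 0 radius \<mu> k) homeomorphic_space top_of_set (model m k)"
      for k
    proof (rule ray_model_homeomorphic)
      show "ray_model (iterated_cone ?X 0 radius \<mu> k) (snd (pointed_iterated_cone ?X 0 radius \<mu> k)) (model m k)"
        using \<mu> scaling_factor_radius X model_scaled_lower model_scaled_upper[OF assms \<mu>]
        by (rule ray_model_iterated_cone)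
    qed
    have "mtopology_of (iterated_cone ?X 0 radius \<mu> i) homeomorphic_space
        mtopology_of (iterated_cone ?X 0 radius \<mu> j) \<longleftrightarrow>
        top_of_set (model m i) homeomorphic_space top_of_set (model m j)"
      using cone[of i] cone[of j] by (meson homeomorphic_space_sym homeomorphic_space_trans)
    also have "\<dots> \<longleftrightarrow> i mod m = j mod m"
    proof
      assume "top_of_set (model m i) homeomorphic_space top_of_set (model m j)"
      then show "i mod m = j mod m"
        using homeomorphic_space_derived_set_card card_derived_set_model[OF assms, of i]
          card_derived_set_model[OF assms, of j] by fastforce
    next
      \<comment> \<open>Congruent indices give the same set of reals, so the two cones are even
        isometric.\<close>
      assume "i mod m = j mod m"
      then show "top_of_set (model m i) homeomorphic_space top_of_set (model m j)"
        using model_cong[of i m j] by (simp add: homeomorphic_space_refl)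
    qed
    finally show ?thesis
      by (simp add: cong_def)
  qed
  moreover have "0 \<in> mspace ?X"
    by (simp add: model_def)
  ultimately show ?thesis
    using scaling_factor_radius by blast
qed

end
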